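(* Let $Q$ be a prime power which is congruent modulo $5$ to either $0$, $2$, or $-2$, and let $\alpha$ be any fixed element of $\mathbb{F}_{Q^2}$ for which $\alpha^{2Q-2}-3\alpha^{Q-1}+1=0$. Then the set of all polynomials $\beta x^{2Q+3}+\alpha\gamma x$ with $\beta,\gamma\in\mathbb{F}_Q$, where at least one of $\beta,\gamma$ is nonzero, corresponds to a complete set of $Q^2-1$ mutually orthogonal latin squares of order $Q^2$.
   Context: For a prime power $q$, $\mathbb{F}_q$ denotes the finite field with $q$ elements, and $\mathbb{F}_Q$ is regarded as a subfield of $\mathbb{F}_{Q^2}$. A latin square of order $n$ is an $n\times n$ matrix with entries from an $n$-element set $S$ such that each element of $S$ occurs exactly once in each row and each column. Two latin squares $[\alpha_{ij}]$ and $[\beta_{ij}]$ with the same set $S$ are orthogonal if every ordered pair in $S\times S$ occurs as $(\alpha_{ij},\beta_{ij})$ for some $i,j$. A set of mutually orthogonal latin squares (MOLS) is a set of pairwise orthogonal latin squares; a complete set of MOLS of order $n$ is a set of $n-1$ MOLS of order $n$. Here $S=\mathbb{F}_q$ with $q=Q^2$, rows and columns are labeled by the elements of $\mathbb{F}_q$, and a polynomial $f$ inducing a permutation of $\mathbb{F}_q$ corresponds to the latin square whose $ij$-th entry is $i+f(j)$, for $i,j\in\mathbb{F}_q$. *)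

theory Defs
  imports
    "HOL-Computational_Algebra.Polynomial"
    "HOL-Number_Theory.Prime_Powers"
    "HOL-Number_Theory.Cong"
    "HOL-Analysis.Finite_Cartesian_Product"
begin

text \<open>
  An \<open>n \<times> n\<close> matrix is an element of the library type \<open>'s ^ 'c ^ 'r\<close> whose rows and columns are
  labelled by arbitrary finite types with \<open>n\<close> elements.
\<close>

definition latin_square :: "nat \<Rightarrow> 's set \<Rightarrow> 's ^ 'c::finite ^ 'r::finite \<Rightarrow> bool" where
  "latin_square n S L \<longleftrightarrow>
     CARD('r) = n \<and> CARD('c) = n \<and> card S = n \<and>
     (\<forall>i j. L $ i $ j \<in> S) \<and>
     (\<forall>s\<in>S. \<forall>i. \<exists>!j. L $ i $ j = s) \<and>
     (\<forall>s\<in>S. \<forall>j. \<exists>!i. L $ i $ j = s)"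

definition orthogonal_squares ::
    "'s set \<Rightarrow> 's ^ 'c::finite ^ 'r::finite \<Rightarrow> 's ^ 'c ^ 'r \<Rightarrow> bool" where
  "orthogonal_squares S A B \<longleftrightarrow> (\<forall>a\<in>S. \<forall>b\<in>S. \<exists>i j. A $ i $ j = a \<and> B $ i $ j = b)"

definition mols :: "nat \<Rightarrow> 's set \<Rightarrow> ('s ^ 'c::finite ^ 'r::finite) set \<Rightarrow> bool" where
  "mols n S M \<longleftrightarrow> (\<forall>L\<in>M. latin_square n S L) \<and> pairwise (orthogonal_squares S) M"

definition complete_mols :: "nat \<Rightarrow> 's set \<Rightarrow> ('s ^ 'c::finite ^ 'r::finite) set \<Rightarrow> bool" where
  "complete_mols n S M \<longleftrightarrow> mols n S M \<and> card M = n - 1"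

definition square_of_poly :: 
    "'a::{field,finite} poly \<Rightarrow> 'a::{field,finite} ^ 'a::{field,finite} ^ 'a::{field,finite}" where
  "square_of_poly f = (\<chi> i j. i + poly f j)"

text \<open>Closure under \<open>inverse\<close> needs no side condition because \<open>inverse 0 = 0\<close>.\<close>

definition is_subfield :: "'a::field set \<Rightarrow> bool" where
  "is_subfield K \<longleftrightarrow>
     0 \<in> K \<and> 1 \<in> K \<and>
     (\<forall>x\<in>K. \<forall>y\<in>K. x + y \<in> K \<and> x * y \<in> K) \<and>
     (\<forall>x\<in>K. - x \<in> K \<and> inverse x \<in> K)"

definition poly_family :: "nat \<Rightarrow> 'a::field set \<Rightarrow> 'a \<Rightarrow> 'a poly set" where
  "poly_family Q K \<alpha> =
     {monom \<beta> (2 * Q + 3) + monom (\<alpha> * \<gamma>) 1 | \<beta> \<gamma>.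
        \<beta> \<in> K \<and> \<gamma> \<in> K \<and> (\<beta> \<noteq> 0 \<or> \<gamma> \<noteq> 0)}"

end

theory Submission imports Defs "HOL-Number_Theory.Residues" begin

text \<open>
  Differences of members of the family are again in the family, so everything reduces to showing
  that each member is a permutation. For \<open>\<beta> \<noteq> 0\<close> and \<open>a = \<alpha> \<gamma> / \<beta>\<close> it is a multiple of
  \<open>f x = x (N x\<^sup>2 + a)\<close>, where \<open>N x = x^(Q + 1)\<close> is the norm. Taking norms of \<open>f x\<close> gives a quintic
  in \<open>N x\<close>, and the equation for \<open>w = \<alpha>^(Q - 1)\<close> makes this quintic a Dickson polynomial outside
  characteristic 5, or \<open>n^5 - a\<^sup>2 n\<close> in characteristic 5. It is injective on the subfield: outside
  characteristic 5, \<open>w\<close> lies outside the subfield, so \<open>t\<^sup>2 - 3 t + 1\<close> has no root there. Hence \<open>f x\<close>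
  determines \<open>N x\<close>, and then \<open>x\<close>. The automorphism \<open>\<sigma>\<close> stands for \<open>x \<mapsto> x^Q\<close>, and the
  subfield for its fixed points.
\<close>

hide_const (open) up_ring.monom up_ring.coeff

section \<open>Involutive field automorphisms and the binomial\<close>

locale field_involution =
  fixes \<sigma> :: "'a::field \<Rightarrow> 'a"
  assumes add: "\<sigma> (x + y) = \<sigma> x + \<sigma> y"
    and mult: "\<sigma> (x * y) = \<sigma> x * \<sigma> y"
    and invol: "\<sigma> (\<sigma> x) = x"
begin

lemma zero [simp]: "\<sigma> 0 = 0"
  using add[of 0 0] by (metis add_0 add_cancel_left_left)

lemma one [simp]: "\<sigma> 1 = 1"
  by (metis invol mult mult_1_right mult.commute)

lemma minus: "\<sigma> (- x) = - \<sigma> x"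
  using add[of x "- x"] by (simp add: eq_neg_iff_add_eq_0 add.commute)

lemma diff: "\<sigma> (x - y) = \<sigma> x - \<sigma> y"
  using add[of x "- y"] by (simp add: minus)

lemma power: "\<sigma> (x ^ n) = \<sigma> x ^ n"
  by (induction n) (simp_all add: mult)

lemma of_nat: "\<sigma> (of_nat n) = of_nat n"
  by (induction n) (simp_all add: add)

lemma numeral [simp]: "\<sigma> (numeral n) = numeral n"
  using of_nat[of "numeral n"] by simp

lemma divide: "\<sigma> (x / y) = \<sigma> x / \<sigma> y"
proof (cases "y = 0")
  case False
  then have "\<sigma> (x / y) * \<sigma> y = \<sigma> x" "\<sigma> y \<noteq> 0"
    by (simp flip: mult) (metis invol zero False)
  then show ?thesis by (simp add: field_simps)
qed simp

lemmas hom_simps = add mult minus diff power divide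

end

text \<open>If \<sigma> scales a nonzero element by \<open>w\<close>, applying \<sigma> twice forces
  norm 1. Over the reals the roots of \<open>t^2 - 3 t + 1\<close> are the squares of the golden
  ratio and its conjugate.\<close>

locale golden_twist = field_involution +
  fixes w
  assumes norm_w: "w * \<sigma> w = 1"
    and w_quadratic: "w\<^sup>2 - 3 * w + 1 = 0"
begin

text \<open>A nonzero \<open>a\<close> would give \<open>w = 1\<close>, but 1 - 3 + 1 = -1.\<close>

lemma twisted_fixed:
  assumes "\<sigma> a = w * a" "\<sigma> a = a"
  shows "a = 0"
  using assms w_quadratic by auto

text \<open>The roots are \<open>w\<close> and \<open>3 - w\<close>, so a fixed root makes
  \<open>w\<close> fixed. Norm 1 then gives \<open>w^2 = 1\<close>, the quadratic gives
  \<open>3 w = 2\<close>, and squaring yields 9 = 4.\<close>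

lemma fixed_quadratic_root:
  assumes "\<sigma> t = t" "t\<^sup>2 - 3 * t + 1 = 0"
  shows "(5 :: 'a) = 0"
proof -
  have "(t - w) * (t - (3 - w)) = (t\<^sup>2 - 3 * t + 1) - (w\<^sup>2 - 3 * w + 1)"
    by (simp add: power2_eq_square algebra_simps)
  then have "(t - w) * (t - (3 - w)) = 0" using assms(2) w_quadratic by simp
  then have "w = t \<or> w = 3 - t" by auto
  then have "\<sigma> w = w" using assms(1) by (auto simp: diff)
  then have "w\<^sup>2 = 1" using norm_w by (simp add: power2_eq_square)
  then have w: "3 * w = 2" using w_quadratic by (simp add: algebra_simps)
  have "9 * w\<^sup>2 = (3 * w)\<^sup>2" by (simp add: power_mult_distrib)
  then have "(9 :: 'a) = 4" using w \<open>w\<^sup>2 = 1\<close> by simp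
  then have "(9 :: 'a) - 4 = 0" by simp
  then show ?thesis by simp
qed

lemma fixed_quadratic_form:
  assumes "(5 :: 'a) \<noteq> 0" "\<sigma> u = u" "\<sigma> v = v" "u\<^sup>2 - 3 * u * v + v\<^sup>2 = 0"
  shows "u = 0 \<and> v = 0"
proof -
  have "v = 0"
  proof (rule ccontr)
    assume "v \<noteq> 0"
    then have "(u / v)\<^sup>2 - 3 * (u / v) + 1 = 0"
      using assms(4) by (simp add: field_simps power2_eq_square)
    then show False using fixed_quadratic_root[of "u / v"] assms by (simp add: divide)
  qed
  then show ?thesis using assms(4) by simp
qed

text \<open>
  Here \<open>x^5 - 5 b x^3 + 5 b\<^sup>2 x\<close> is the Dickson polynomial of degree 5. Its difference quotient is
  the form \<open>A\<^sup>2 + A B - B\<^sup>2\<close> in \<open>A = x\<^sup>2 + y\<^sup>2 - 3 b\<close> and \<open>B = x y + b\<close>.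
\<close>

lemma dickson5_inj:
  assumes "(5 :: 'a) \<noteq> 0" "\<sigma> b = b" "\<sigma> x = x" "\<sigma> y = y"
    and eq: "x ^ 5 - 5 * b * x ^ 3 + 5 * b\<^sup>2 * x = y ^ 5 - 5 * b * y ^ 3 + 5 * b\<^sup>2 * y"
  shows "x = y"
proof (rule ccontr)
  assume "x \<noteq> y"
  define A where "A = x\<^sup>2 + y\<^sup>2 - 3 * b"
  define B where "B = x * y + b"
  \<comment> \<open>Replacing \<open>A\<close> by \<open>B - A\<close> turns
    \<open>A^2 + A B - B^2\<close> into the form of \<open>fixed_quadratic_form\<close>.\<close>
  have "(x - y) * ((B - A)\<^sup>2 - 3 * (B - A) * B + B\<^sup>2) =
      (x ^ 5 - 5 * b * x ^ 3 + 5 * b\<^sup>2 * x) - (y ^ 5 - 5 * b * y ^ 3 + 5 * b\<^sup>2 * y)"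
    by (simp add: A_def B_def eval_nat_numeral algebra_simps)
  also have "\<dots> = 0" using eq by simp
  finally have "(B - A)\<^sup>2 - 3 * (B - A) * B + B\<^sup>2 = 0" using \<open>x \<noteq> y\<close> by simp
  moreover have "\<sigma> (B - A) = B - A" "\<sigma> B = B"
    using assms by (simp_all add: A_def B_def hom_simps)
  ultimately have "A = 0" "B = 0" using fixed_quadratic_form[of "B - A" B] assms(1) by auto
  \<comment> \<open>The combination \<open>A + 3 B\<close> eliminates \<open>b\<close> and is the
    same form again, at \<open>- x\<close> and \<open>y\<close>.\<close>
  moreover have "(- x)\<^sup>2 - 3 * (- x) * y + y\<^sup>2 = A + 3 * B"
    by (simp add: A_def B_def algebra_simps)
  ultimately have "(- x)\<^sup>2 - 3 * (- x) * y + y\<^sup>2 = 0" by simp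
  then have "- x = 0 \<and> y = 0" using assms by (intro fixed_quadratic_form) (auto simp: minus)
  then show False using \<open>x \<noteq> y\<close> by simp
qed

lemma norm_poly_inj:
  assumes sigma_a: "\<sigma> a = w * a"
    and "\<sigma> x = x" "\<sigma> y = y"
    and eq: "x * ((x\<^sup>2 + a) * (x\<^sup>2 + \<sigma> a)) = y * ((y\<^sup>2 + a) * (y\<^sup>2 + \<sigma> a))"
  shows "x = y"
proof (cases "(5 :: 'a) = 0")
  case True
  have "(w + 1)\<^sup>2 = (w\<^sup>2 - 3 * w + 1) + 5 * w" by (simp add: power2_eq_square algebra_simps)
  then have "(w + 1)\<^sup>2 = 0" using w_quadratic True by simp
  then have w: "w = - 1" by (simp add: eq_neg_iff_add_eq_0)
  \<comment> \<open>In characteristic 5 the map \<open>z^5 - a^2 z\<close> is additive, so the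
    difference of its values is its value at \<open>x - y\<close>. The multiple of 5 makes this an
    identity over any commutative ring.\<close>
  have "(x - y) * ((x - y)\<^sup>2 - a) * ((x - y)\<^sup>2 + a) =
      x * ((x\<^sup>2 + a) * (x\<^sup>2 - a)) - y * ((y\<^sup>2 + a) * (y\<^sup>2 - a))
      + 5 * (x * y * (y ^ 3 - x ^ 3 + 2 * x\<^sup>2 * y - 2 * x * y\<^sup>2))"
    by (simp add: eval_nat_numeral algebra_simps)
  also have "\<dots> = 0" using eq True by (simp add: sigma_a w)
  finally have "(x - y) * ((x - y)\<^sup>2 - a) * ((x - y)\<^sup>2 + a) = 0" .
  then have "x = y \<or> a = (x - y)\<^sup>2 \<or> a = - (x - y)\<^sup>2"
    by (auto simp: eq_neg_iff_add_eq_0 add.commute)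
  then show ?thesis
  proof
    assume a: "a = (x - y)\<^sup>2 \<or> a = - (x - y)\<^sup>2"
    then have "\<sigma> a = a" using assms(2,3) by (auto simp: hom_simps)
    then have "a = 0" by (rule twisted_fixed[OF sigma_a])
    then show ?thesis using a by auto
  qed
next
  case False
  \<comment> \<open>The cubic coefficient dictates \<open>b\<close>. The linear coefficient then
    matches because the quadratic for \<open>w\<close> says \<open>(1 + w)^2 = 5 w\<close>.\<close>
  define b where "b = - (a + \<sigma> a) / 5"
  have b: "5 * b = - (a + w * a)" using False by (simp add: b_def sigma_a)
  have "\<sigma> b = b" by (simp add: b_def hom_simps invol add.commute)
  have "5 * (5 * b\<^sup>2) = (5 * b)\<^sup>2" by (simp add: power2_eq_square)
  also have "\<dots> = a\<^sup>2 * (w\<^sup>2 - 3 * w + 1) + 5 * (w * a\<^sup>2)"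
    unfolding b by (simp add: power2_eq_square algebra_simps)
  finally have "5 * (5 * b\<^sup>2) = 5 * (w * a\<^sup>2)" using w_quadratic by simp
  then have b2: "5 * b\<^sup>2 = w * a\<^sup>2" using False by (metis mult_left_cancel)
  have "z ^ 5 - 5 * b * z ^ 3 + 5 * b\<^sup>2 * z = z * ((z\<^sup>2 + a) * (z\<^sup>2 + \<sigma> a))" for z
    unfolding b b2 sigma_a by (simp add: eval_nat_numeral algebra_simps)
  then show ?thesis using dickson5_inj[OF False \<open>\<sigma> b = b\<close>] assms by simp
qed

lemma binomial_inj:
  assumes sigma_a: "\<sigma> a = w * a"
  shows "inj (\<lambda>x. x * ((x * \<sigma> x)\<^sup>2 + a))"
proof (rule injI)
  fix x y
  assume eq: "x * ((x * \<sigma> x)\<^sup>2 + a) = y * ((y * \<sigma> y)\<^sup>2 + a)"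
  define n where "n = (\<lambda>x. x * \<sigma> x)"
  have fixed: "\<sigma> (n z) = n z" for z by (simp add: n_def mult invol ac_simps)
  have norm: "z * ((z * \<sigma> z)\<^sup>2 + a) * \<sigma> (z * ((z * \<sigma> z)\<^sup>2 + a))
      = n z * (((n z)\<^sup>2 + a) * ((n z)\<^sup>2 + \<sigma> a))" for z
    by (simp add: n_def hom_simps invol ac_simps)
  have nxy: "n x = n y"
    by (rule norm_poly_inj[OF sigma_a]) (use norm[of x] norm[of y] eq fixed in simp_all)
  show "x = y"
  \<comment> \<open>Recovering \<open>x\<close> means cancelling this common factor. If it vanishes,
    \<open>a\<close> is fixed, hence 0, and both norms are 0.\<close>
  proof (cases "(n x)\<^sup>2 + a = 0")
    case True
    then have a: "a = - (n x)\<^sup>2" by (simp add: eq_neg_iff_add_eq_0 add.commute)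
    then have "\<sigma> a = a" using fixed by (simp add: hom_simps)
    then have "a = 0" by (rule twisted_fixed[OF sigma_a])
    then have "n x = 0" "n y = 0" using a nxy by auto
    moreover have "z = 0" if "n z = 0" for z
      using that zero invol[of z] by (auto simp: n_def)
    ultimately have "x = 0" "y = 0" by blast+
    then show ?thesis by simp
  next
    case False
    then show ?thesis using eq nxy by (simp add: n_def)
  qed
qed

end

section \<open>Frobenius maps on finite fields\<close>

lemma subfield_power_card:
  fixes K :: "'a::{field,finite} set"
  assumes "is_subfield K" "x \<in> K"
  shows "x ^ card K = x"
proof (cases "x = 0")
  case True
  then show ?thesis using assms by (auto simp: power_0_left card_eq_0_iff)
next
  case False
  have K: "u * v \<in> K" "v / u \<in> K" if "u \<in> K" "v \<in> K" for u v
    using assms(1) that by (auto simp: is_subfield_def divide_inverse)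
  \<comment> \<open>As in Fermat's little theorem, multiplication by \<open>x\<close> permutes
    \<open>K - {0}\<close>.\<close>
  have "(\<Prod>y\<in>K-{0}. x * y) = (\<Prod>y\<in>K-{0}. y)"
    by (rule prod.reindex_bij_witness[of _ "\<lambda>y. y / x" "\<lambda>y. x * y"]) (use False assms K in auto)
  then have "x ^ card (K - {0}) * (\<Prod>y\<in>K-{0}. y) = (\<Prod>y\<in>K-{0}. y)"
    by (simp add: prod.distrib)
  then have "x ^ card (K - {0}) = 1" by simp
  moreover have "card K = Suc (card (K - {0}))"
    using assms(1) by (metis card.remove finite is_subfield_def)
  ultimately show ?thesis by simp
qed

lemma power_card_UNIV: "x ^ CARD('a) = (x :: 'a::{field,finite})"
  by (rule subfield_power_card) (auto simp: is_subfield_def)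

text \<open>The characteristic divides the order of the field, so \<open>Q\<close> is a power of it
  and the map is additive. Its square is the power map of exponent \<open>Q^2\<close>, the
  identity.\<close>

lemma frobenius_involution:
  fixes Q :: nat
  assumes "primepow Q" "CARD('a::{field,finite}) = Q\<^sup>2"
  shows "field_involution (\<lambda>x::'a. x ^ Q)"
proof
  obtain p k where pk: "prime p" "Q = p ^ k" using assms(1) by (auto simp: primepow_def)
  have prime: "prime CHAR('a)"
    by (simp add: finite_imp_CHAR_pos prime_CHAR_semidom)
  moreover have "CHAR('a) dvd p ^ (k * 2)"
    using CHAR_dvd_CARD[where 'a = 'a] assms(2) pk by (simp add: power_mult)
  ultimately have "CHAR('a) = p"
    using pk(1) prime_dvd_power primes_dvd_imp_eq by blast
  then show "(x + y) ^ Q = x ^ Q + y ^ Q" for x y :: 'a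
    using freshmans_dream' prime pk(2) by blast
  show "(x * y) ^ Q = x ^ Q * y ^ Q" for x y :: 'a by (rule power_mult_distrib)
  show "(x ^ Q) ^ Q = x" for x :: 'a
    using power_card_UNIV[of x] assms(2) by (simp add: power_mult power2_eq_square)
qed

section \<open>Latin squares from polynomials\<close>

lemma latin_square_of_poly:
  fixes f :: "'a::{field,finite} poly"
  assumes "bij (poly f)"
  shows "latin_square CARD('a) UNIV (square_of_poly f)"
  unfolding latin_square_def square_of_poly_def
proof (intro conjI ballI allI)
  fix s i :: 'a
  show "\<exists>!j. (\<chi> i j. i + poly f j) $ i $ j = s"
  proof -
    have "\<exists>!j. poly f j = s - i" using assms by (simp add: bij_iff)
    then show ?thesis by (simp add: eq_diff_eq add.commute)
  qed
next
  fix s j :: 'a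
  show "\<exists>!i. (\<chi> i j. i + poly f j) $ i $ j = s"
    by (rule ex1I[of _ "s - poly f j"]) (auto simp: algebra_simps)
qed auto

text \<open>Subtracting the two entry equations eliminates the row and leaves one equation for the
  column.\<close>

lemma orthogonal_squares_of_poly:
  assumes "surj (poly (f - g))"
  shows "orthogonal_squares UNIV (square_of_poly f) (square_of_poly g)"
  unfolding orthogonal_squares_def
proof (intro ballI)
  fix a b
  obtain j where "a - b = poly (f - g) j" using assms by (rule surjE)
  then show "\<exists>i j. square_of_poly f $ i $ j = a \<and> square_of_poly g $ i $ j = b"
    by (intro exI[of _ "a - poly f j"] exI[of _ j]) (auto simp: square_of_poly_def algebra_simps)
qed

text \<open>Needed to count squares by counting polynomials: when degrees reach the field order
  (degree 7 over 4 elements for \<open>Q = 2\<close>), distinct polynomials may induce equal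
  functions. A surjective difference rules this out.\<close>

lemma inj_on_square_of_poly:
  fixes F :: "'a::{field,finite} poly set"
  assumes "\<And>f g. f \<in> F \<Longrightarrow> g \<in> F \<Longrightarrow> f \<noteq> g \<Longrightarrow> surj (poly (f - g))"
  shows "inj_on square_of_poly F"
proof (rule inj_onI, rule ccontr)
  fix f g
  assume fg: "f \<in> F" "g \<in> F" "square_of_poly f = square_of_poly g" "f \<noteq> g"
  have "poly (f - g) x = 0" for x
    using arg_cong[OF fg(3), of "\<lambda>L. L $ 0 $ x"] by (simp add: square_of_poly_def)
  moreover obtain x where "1 = poly (f - g) x" using assms fg by (meson surjE)
  ultimately show False by simp
qed

lemma mols_of_polys:
  fixes F :: "'a::{field,finite} poly set"
  assumes "\<And>f. f \<in> F \<Longrightarrow> bij (poly f)"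
    and "\<And>f g. f \<in> F \<Longrightarrow> g \<in> F \<Longrightarrow> f \<noteq> g \<Longrightarrow> surj (poly (f - g))"
  shows "mols CARD('a) UNIV (square_of_poly ` F)"
  unfolding mols_def pairwise_def
proof (intro conjI ballI impI)
  fix L
  assume "L \<in> square_of_poly ` F"
  then show "latin_square CARD('a) UNIV L" using assms(1) latin_square_of_poly by blast
next
  fix L M
  assume "L \<in> square_of_poly ` F" "M \<in> square_of_poly ` F" "L \<noteq> M"
  then show "orthogonal_squares UNIV L M" using assms(2) orthogonal_squares_of_poly by blast
qed

section \<open>The family of binomials\<close>

lemma poly_family_diff:
  assumes "is_subfield K" "f \<in> poly_family Q K \<alpha>" "g \<in> poly_family Q K \<alpha>" "f \<noteq> g"
  shows "f - g \<in> poly_family Q K \<alpha>"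
proof -
  have K: "u - v \<in> K" if "u \<in> K" "v \<in> K" for u v
    using assms(1) that unfolding is_subfield_def by (metis diff_conv_add_uminus)
  obtain \<beta> \<gamma> \<beta>' \<gamma>' where fg:
    "f = monom \<beta> (2 * Q + 3) + monom (\<alpha> * \<gamma>) 1" "g = monom \<beta>' (2 * Q + 3) + monom (\<alpha> * \<gamma>') 1"
    "\<beta> \<in> K" "\<gamma> \<in> K" "\<beta>' \<in> K" "\<gamma>' \<in> K"
    using assms(2,3) unfolding poly_family_def by blast
  moreover have "f - g = monom (\<beta> - \<beta>') (2 * Q + 3) + monom (\<alpha> * (\<gamma> - \<gamma>')) 1"
    by (simp add: fg right_diff_distrib flip: diff_monom)
  moreover have "\<beta> - \<beta>' \<noteq> 0 \<or> \<gamma> - \<gamma>' \<noteq> 0" using assms(4) fg by auto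
  ultimately show ?thesis unfolding poly_family_def using K by blast
qed

lemma card_poly_family:
  fixes K :: "'a::field set"
  assumes "finite K" "0 \<in> K" "\<alpha> \<noteq> 0"
  shows "card (poly_family Q K \<alpha>) = (card K)\<^sup>2 - 1"
proof -
  define h where "h = (\<lambda>(\<beta>, \<gamma>). monom \<beta> (2 * Q + 3) + monom (\<alpha> * \<gamma>) 1)"
  have coeffs: "coeff (h (\<beta>, \<gamma>)) (2 * Q + 3) = \<beta>" "coeff (h (\<beta>, \<gamma>)) 1 = \<alpha> * \<gamma>" for \<beta> \<gamma>
    by (auto simp: h_def)
  have "inj h"
  proof (rule injI, clarify)
    fix \<beta> \<gamma> \<beta>' \<gamma>'
    assume "h (\<beta>, \<gamma>) = h (\<beta>', \<gamma>')"
    then show "\<beta> = \<beta>' \<and> \<gamma> = \<gamma>'" using coeffs assms(3) by (metis mult_left_cancel)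
  qed
  then have "inj_on h (K \<times> K - {(0, 0)})" by (rule inj_on_subset) simp
  moreover have "poly_family Q K \<alpha> = h ` (K \<times> K - {(0, 0)})"
  proof (intro equalityI subsetI)
    fix f
    assume "f \<in> poly_family Q K \<alpha>"
    then obtain \<beta> \<gamma> where "f = h (\<beta>, \<gamma>)" "(\<beta>, \<gamma>) \<in> K \<times> K - {(0, 0)}"
      unfolding poly_family_def h_def by auto
    then show "f \<in> h ` (K \<times> K - {(0, 0)})" by (rule image_eqI)
  next
    fix f
    assume "f \<in> h ` (K \<times> K - {(0, 0)})"
    then show "f \<in> poly_family Q K \<alpha>" unfolding poly_family_def h_def by auto
  qed
  ultimately have "card (poly_family Q K \<alpha>) = card (K \<times> K - {(0, 0)})"
    by (simp add: card_image)
  then show ?thesis using assms by (simp add: card_cartesian_product power2_eq_square)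
qed

theorem corollary4p3:
  fixes Q :: nat and K :: "'a::{field,finite} set" and \<alpha> :: 'a
  assumes "primepow Q"
    and "[int Q = 0] (mod 5) \<or> [int Q = 2] (mod 5) \<or> [int Q = - 2] (mod 5)"
    and "CARD('a) = Q ^ 2"
    and "is_subfield K" and "card K = Q"
    and "\<alpha> ^ (2 * Q - 2) - 3 * \<alpha> ^ (Q - 1) + 1 = 0"
  shows "(\<forall>f\<in>poly_family Q K \<alpha>. bij (poly f)) \<and>
         complete_mols (Q ^ 2) (UNIV :: 'a set) (square_of_poly ` poly_family Q K \<alpha>)"
proof -
  have Q: "Q > 1" using assms(1) using primepow_gt_Suc_0 by fastforce
  have "\<alpha> \<noteq> 0" using assms(6) Q by (auto simp: power_0_left split: if_splits)
  interpret field_involution "\<lambda>x::'a. x ^ Q"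
    using assms(1,3) by (rule frobenius_involution)
  define w where "w = \<alpha> ^ (Q - 1)"
  have "2 * Q - 2 = (Q - 1) * 2" by simp
  then have w: "w\<^sup>2 - 3 * w + 1 = 0" using assms(6) unfolding w_def by (simp add: power_mult)
  have w\<alpha>: "\<alpha> ^ Q = w * \<alpha>" using Q by (simp add: w_def flip: power_Suc2)
  \<comment> \<open>Apply the Frobenius map twice to \<alpha>.\<close>
  have "w * w ^ Q * \<alpha> = \<alpha>"
    using invol[of \<alpha>] by (simp add: w\<alpha> mult ac_simps)
  then interpret golden_twist "\<lambda>x. x ^ Q" w
    using w \<open>\<alpha> \<noteq> 0\<close> by unfold_locales auto
  have bij: "bij (poly f)" if f: "f \<in> poly_family Q K \<alpha>" for f
  proof -
    obtain \<beta> \<gamma> where f: "f = monom \<beta> (2 * Q + 3) + monom (\<alpha> * \<gamma>) 1"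
      and K: "\<beta> \<in> K" "\<gamma> \<in> K" and nz: "\<beta> \<noteq> 0 \<or> \<gamma> \<noteq> 0"
      using f unfolding poly_family_def by blast
    \<comment> \<open>The exponent is \<open>1 + 2 (Q + 1)\<close>: \<open>x\<close> times the
      squared norm.\<close>
    have pw: "x ^ (2 * Q + 3) = x * (x * x ^ Q)\<^sup>2" for x :: 'a
      by (simp add: power_add power_mult power_mult_distrib power2_eq_square power3_eq_cube)
    have fx: "poly f x = \<beta> * (x * (x * x ^ Q)\<^sup>2) + \<alpha> * \<gamma> * x" for x
      by (simp add: f poly_monom pw)
    have KQ: "u ^ Q = u" if "u \<in> K" for u using subfield_power_card assms(4,5) that by metis
    have "inj (poly f)"
    proof (cases "\<beta> = 0")
      case True
      then show ?thesis using nz \<open>\<alpha> \<noteq> 0\<close> by (auto simp: fx inj_def)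
    next
      case False
      \<comment> \<open>The factor \<gamma> / \<beta> lies in \<open>K\<close> and is fixed, so the
        product inherits the twist of \<alpha>.\<close>
      have "(\<alpha> * \<gamma> / \<beta>) ^ Q = w * (\<alpha> * \<gamma> / \<beta>)"
        using KQ K w\<alpha> by (simp add: power_divide power_mult_distrib)
      then have "inj (\<lambda>x. x * ((x * x ^ Q)\<^sup>2 + \<alpha> * \<gamma> / \<beta>))" by (rule binomial_inj)
      moreover have "poly f = (\<lambda>x. \<beta> * x) \<circ> (\<lambda>x. x * ((x * x ^ Q)\<^sup>2 + \<alpha> * \<gamma> / \<beta>))"
        using False by (simp add: fun_eq_iff fx field_simps)
      moreover have "inj (\<lambda>x. \<beta> * x)" using False by (simp add: inj_def)
      ultimately show ?thesis by (simp only: inj_compose)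
    qed
    then show ?thesis by (simp add: bij_def finite_UNIV_inj_surj)
  qed
  have "surj (poly (f - g))"
    if "f \<in> poly_family Q K \<alpha>" "g \<in> poly_family Q K \<alpha>" "f \<noteq> g" for f g
    using poly_family_diff[OF assms(4) that] by (intro bij_is_surj bij)
  then show ?thesis
    using bij mols_of_polys[of "poly_family Q K \<alpha>"] inj_on_square_of_poly[of "poly_family Q K \<alpha>"]
      card_poly_family[of K \<alpha> Q] \<open>\<alpha> \<noteq> 0\<close> assms(3,4,5)
    by (simp add: complete_mols_def card_image is_subfield_def)
qed

end
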